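(* Let $g_1, \dots, g_m \in \mathbb{R}[x]$, $x=(x_1,\dots,x_n)$, be such that $S=\{x\in \mathbb{R}^n: g_1(x)\ge 0,\dots,g_m(x)\ge 0\}$ is a non-empty compact set. Let $L,U \in \mathbb{R}^n$ be such that $S \subseteq \{x \in \mathbb{R}^n: L \le x \le U\}$. If $p\in\mathbb{R}[x]$ satisfies $p(x)>0$ for all $x\in S$, then there exist $r \ge 0$ and SDSOS (or DSOS) polynomials $q_{\alpha, \beta, \gamma} \in \mathbb{R}_{r}[x]$ for $(\alpha, \beta,\gamma) \in \mathbb{N}^{2n+m}_{r}$ such that $$p(x) = \sum_{(\alpha, \beta,\gamma ) \in \mathbb{N}^{2n+m}_{r} } q_{\alpha, \beta,\gamma}(x)\, (x-L)^{\alpha} (U-x)^{\beta}g(x)^\gamma .$$ (That is, the statement holds with all $q_{\alpha,\beta,\gamma}$ SDSOS, and also with all $q_{\alpha,\beta,\gamma}$ DSOS.)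
   Context: $\mathbb{R}_r[x]$ is the set of real polynomials of degree at most $r$. $\mathbb{N}$ includes $0$; $\mathbb{N}^{k}_r=\{\alpha\in\mathbb{N}^k:\sum_i\alpha_i\le r\}$; in $(\alpha,\beta,\gamma)\in\mathbb{N}^{2n+m}_r$ one has $\alpha,\beta\in\mathbb{N}^n$, $\gamma\in\mathbb{N}^m$. Vector inequalities are componentwise, and $(x-L)^\alpha=\prod_i(x_i-L_i)^{\alpha_i}$, $(U-x)^\beta=\prod_i(U_i-x_i)^{\beta_i}$, $g(x)^\gamma=\prod_j g_j(x)^{\gamma_j}$. A polynomial is DSOS (diagonally dominant sum of squares) if it can be written as $\sum_i a_i m_i(x)^2+\sum_{i,j} b^+_{ij}(m_i(x)+m_j(x))^2+\sum_{i,j} b^-_{ij}(m_i(x)-m_j(x))^2$ for finitely many monomials $m_i$ and nonnegative scalars $a_i,b^+_{ij},b^-_{ij}$. It is SDSOS (scaled diagonally dominant sum of squares) if it can be written as $\sum_i a_i m_i(x)^2+\sum_{i,j}(b^+_{ij}m_i(x)+c^+_{ij}m_j(x))^2+\sum_{i,j}(b^-_{ij}m_i(x)-c^-_{ij}m_j(x))^2$ for finitely many monomials $m_i$, scalars $a_i\ge 0$ and real scalars $b^\pm_{ij},c^\pm_{ij}$. *)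

theory Defs
  imports "HOL-Analysis.Analysis" "HOL-Library.Poly_Mapping"
begin

text \<open>
  The polynomial ring in the variables indexed by the finite type \<open>'n\<close>: a monomial is its exponent
  vector of type \<open>'n \<Rightarrow>\<^sub>0 nat\<close>, a polynomial is its finitely supported family of coefficients, and
  the ring operations are those of \<^typ>\<open>'a \<Rightarrow>\<^sub>0 'b\<close> (convolution product).
\<close>

type_synonym 'n rpoly = "('n \<Rightarrow>\<^sub>0 nat) \<Rightarrow>\<^sub>0 real"

definition Const :: "real \<Rightarrow> 'n rpoly"
  where "Const c = Poly_Mapping.single 0 c"

definition Var :: "'n \<Rightarrow> 'n rpoly"
  where "Var i = Poly_Mapping.single (Poly_Mapping.single i 1) 1"

definition Monom :: "('n \<Rightarrow>\<^sub>0 nat) \<Rightarrow> 'n rpoly"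
  where "Monom e = Poly_Mapping.single e 1"

definition peval :: "('n::finite) rpoly \<Rightarrow> real ^ 'n \<Rightarrow> real"
  where "peval p x =
    (\<Sum>e\<in>Poly_Mapping.keys p. Poly_Mapping.lookup p e * (\<Prod>i\<in>UNIV. (x $ i) ^ Poly_Mapping.lookup e i))"

definition polys_upto :: "nat \<Rightarrow> ('n::finite) rpoly set"
  where "polys_upto r =
    {p. \<forall>e\<in>Poly_Mapping.keys p. (\<Sum>i\<in>UNIV. Poly_Mapping.lookup e i) \<le> r}"

text \<open>
  As usual for DSOS polynomials, monomials have coefficient \<open>1\<close>; with arbitrary coefficients the
  DSOS and SDSOS classes would coincide. The family \<open>e\<close> below need not be injective.
\<close>

definition dsos :: "'n rpoly \<Rightarrow> bool"
  where "dsos p \<longleftrightarrow>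
    (\<exists>(k::nat) (e :: nat \<Rightarrow> 'n \<Rightarrow>\<^sub>0 nat) (a :: nat \<Rightarrow> real)
        (bp :: nat \<Rightarrow> nat \<Rightarrow> real) (bm :: nat \<Rightarrow> nat \<Rightarrow> real).
      (\<forall>i<k. 0 \<le> a i) \<and> (\<forall>i<k. \<forall>j<k. 0 \<le> bp i j \<and> 0 \<le> bm i j) \<and>
      p = (\<Sum>i<k. Const (a i) * Monom (e i) ^ 2)
        + (\<Sum>i<k. \<Sum>j<k. Const (bp i j) * (Monom (e i) + Monom (e j)) ^ 2)
        + (\<Sum>i<k. \<Sum>j<k. Const (bm i j) * (Monom (e i) - Monom (e j)) ^ 2))"

definition sdsos :: "'n rpoly \<Rightarrow> bool"
  where "sdsos p \<longleftrightarrow>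
    (\<exists>(k::nat) (e :: nat \<Rightarrow> 'n \<Rightarrow>\<^sub>0 nat) (a :: nat \<Rightarrow> real)
        (bp :: nat \<Rightarrow> nat \<Rightarrow> real) (cp :: nat \<Rightarrow> nat \<Rightarrow> real)
        (bm :: nat \<Rightarrow> nat \<Rightarrow> real) (cm :: nat \<Rightarrow> nat \<Rightarrow> real).
      (\<forall>i<k. 0 \<le> a i) \<and>
      p = (\<Sum>i<k. Const (a i) * Monom (e i) ^ 2)
        + (\<Sum>i<k. \<Sum>j<k. (Const (bp i j) * Monom (e i) + Const (cp i j) * Monom (e j)) ^ 2)
        + (\<Sum>i<k. \<Sum>j<k. (Const (bm i j) * Monom (e i) - Const (cm i j) * Monom (e j)) ^ 2))"

definition multi_indices ::
    "nat \<Rightarrow> (('n::finite \<Rightarrow> nat) \<times> ('n \<Rightarrow> nat) \<times> ('m::finite \<Rightarrow> nat)) set"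
  where "multi_indices r =
    {(\<alpha>, \<beta>, \<gamma>). (\<Sum>i\<in>UNIV. \<alpha> i) + (\<Sum>i\<in>UNIV. \<beta> i) + (\<Sum>j\<in>UNIV. \<gamma> j) \<le> r}"

text \<open>The product \<open>(x - L)\<^sup>\<alpha> (U - x)\<^sup>\<beta> g\<^sup>\<gamma>\<close> as an element of the polynomial ring.\<close>

definition box_product ::
    "real ^ 'n \<Rightarrow> real ^ 'n \<Rightarrow> ('m \<Rightarrow> 'n rpoly) \<Rightarrow>
      ('n \<Rightarrow> nat) \<Rightarrow> ('n \<Rightarrow> nat) \<Rightarrow> ('m \<Rightarrow> nat) \<Rightarrow> ('n::finite) rpoly"
  where "box_product L U g \<alpha> \<beta> \<gamma> =
    (\<Prod>i\<in>UNIV. (Var i - Const (L $ i)) ^ \<alpha> i) *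
    (\<Prod>i\<in>UNIV. (Const (U $ i) - Var i) ^ \<beta> i) *
    (\<Prod>j\<in>UNIV. g j ^ \<gamma> j)"

lemma finite_bounded_fun: "finite {f :: 'b::finite \<Rightarrow> nat. \<forall>i. f i \<le> r}"
  using finite_PiE[of "UNIV :: 'b set" "\<lambda>_. {..r}"] by (simp add: PiE_UNIV_domain Pi_def)

lemma le_sum_UNIV: "f i \<le> (\<Sum>j\<in>UNIV. f j)" for f :: "'b::finite \<Rightarrow> nat"
  by (rule member_le_sum) auto

lemma finite_multi_indices:
  "finite (multi_indices r :: (('n::finite \<Rightarrow> nat) \<times> ('n \<Rightarrow> nat) \<times> ('m::finite \<Rightarrow> nat)) set)"
proof (rule finite_subset)
  show "multi_indices r \<subseteq> {f :: 'n \<Rightarrow> nat. \<forall>i. f i \<le> r} \<times> {f :: 'n \<Rightarrow> nat. \<forall>i. f i \<le> r} \<times>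
      {f :: 'm \<Rightarrow> nat. \<forall>i. f i \<le> r}"
    by (auto simp: multi_indices_def) (metis le_sum_UNIV add_leD1 add_leD2 order_trans)+
qed (simp add: finite_bounded_fun)

lemma peval_superset:
  assumes "finite A" "Poly_Mapping.keys p \<subseteq> A"
  shows "peval p x =
    (\<Sum>e\<in>A. Poly_Mapping.lookup p e * (\<Prod>i\<in>UNIV. (x $ i) ^ Poly_Mapping.lookup e i))"
  unfolding peval_def using assms by (intro sum.mono_neutral_left) (auto simp: in_keys_iff)

lemma peval_zero [simp]: "peval 0 x = 0"
  by (simp add: peval_def)

lemma peval_single:
  "peval (Poly_Mapping.single e c) x = c * (\<Prod>i\<in>UNIV. (x $ i) ^ Poly_Mapping.lookup e i)"
  by (subst peval_superset[of "{e}"]) (auto split: if_splits)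

lemma peval_Const [simp]: "peval (Const c) x = c"
  by (simp add: Const_def peval_single)

lemma peval_Var [simp]: "peval (Var i) x = x $ i"
proof -
  have "(\<Prod>j\<in>UNIV. (x $ j) ^ Poly_Mapping.lookup (Poly_Mapping.single i (1::nat)) j) =
      (\<Prod>j\<in>UNIV. if j = i then x $ j else 1)"
    by (rule prod.cong) (auto simp: lookup_single when_def)
  then show ?thesis by (simp add: Var_def peval_single)
qed

lemma peval_add [simp]: "peval (p + q) x = peval p x + peval q x"
proof -
  let ?A = "Poly_Mapping.keys p \<union> Poly_Mapping.keys q"
  show ?thesis
    using keys_add[of p q] by (simp add: peval_superset[of ?A] lookup_add ring_distribs sum.distrib)
qed

lemma peval_sum [simp]: "peval (sum f A) x = (\<Sum>i\<in>A. peval (f i) x)"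
  by (induction A rule: infinite_finite_induct) auto

lemma peval_mult [simp]: "peval (p * q) x = peval p x * peval q x"
proof -
  have s: "r = (\<Sum>e\<in>Poly_Mapping.keys r. Poly_Mapping.single e (Poly_Mapping.lookup r e))"
    for r :: "'a rpoly"
    by (rule poly_mapping_eqI)
      (auto simp: lookup_sum lookup_single when_def sum.delta in_keys_iff)
  have "peval (p * q) x =
     peval ((\<Sum>e\<in>Poly_Mapping.keys p. Poly_Mapping.single e (Poly_Mapping.lookup p e)) *
       (\<Sum>e\<in>Poly_Mapping.keys q. Poly_Mapping.single e (Poly_Mapping.lookup q e))) x"
    using s[of p] s[of q] by simp
  then show ?thesis
    by (simp add: sum_product mult_single peval_single lookup_add power_add prod.distrib
        peval_def[of p] peval_def[of q] mult_ac)
qed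

end

theory Submission
  imports Defs
begin

text \<open>
  The multipliers can all be taken to be nonnegative constants, which are both DSOS and SDSOS; this
  is Krivine's Positivstellensatz. Write \<open>T\<close> for the nonnegative combinations of the products
  \<open>(x - L)\<^sup>\<alpha> (U - x)\<^sup>\<beta> g\<^sup>\<gamma>\<close>. It is closed under addition and multiplication, so it is enough to
  show that a semiring containing the nonnegative constants and all the generators contains \<open>p\<close>.

  For a polynomial \<open>f\<close> that is positive on the whole box \<open>L \<le> x \<le> U\<close> this is Bernstein's argument
  (lemma \<open>positive_on_proper_box_mem\<close>): the Bernstein basis polynomials of degree \<open>N\<close> of the box
  are products of the \<open>x\<^sub>i - L\<^sub>i\<close> and \<open>U\<^sub>i - x\<^sub>i\<close>, and the coefficients of \<open>f\<close> in that basis differ from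
  the values of \<open>f\<close> on a grid by at most a constant over \<open>N\<close>, so they become nonnegative. If some
  \<open>L\<^sub>i = U\<^sub>i\<close>, the box is first enlarged a little: \<open>f\<close> stays positive by compactness, and
  \<open>U\<^sub>i + \<eta> - x\<^sub>i\<close> still lies in \<open>T\<close>.

  In general \<open>p\<close> is positive only on \<open>S\<close>, and a penalty is subtracted from it (lemma
  \<open>positive_on_semialgebraic_mem\<close>). Scale the \<open>g\<^sub>j\<close> to \<open>G\<^sub>j < 1\<close> on the box; then \<open>1 - G\<^sub>j\<close> is positive
  on the box, so it lies in \<open>T\<close>, and so does \<open>h = \<Sum>\<^sub>j G\<^sub>j (1 - G\<^sub>j)\<^sup>k\<close>. For large \<open>k\<close> each summand
  of \<open>h\<close> is uniformly small where \<open>G\<^sub>j \<ge> 0\<close> and very negative where \<open>G\<^sub>j < 0\<close> (lemma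
  \<open>penalty_bound\<close>). Hence \<open>p - h\<close> is positive on the whole box and lies in \<open>T\<close>, and
  \<open>p = (p - h) + h\<close>.
\<close>

section \<open>Evaluation, constants and variables\<close>

lemma Const_add: "Const (a + b) = Const a + Const b"
  by (simp add: Const_def single_add)

lemma Const_mult: "Const (a * b) = Const a * Const b"
  by (simp add: Const_def mult_single)

lemma Const_zero [simp]: "Const 0 = 0"
  by (simp add: Const_def)

lemma Const_one [simp]: "Const 1 = 1"
  by (simp add: Const_def)

lemma Const_sum: "Const (sum f A) = (\<Sum>i\<in>A. Const (f i))"
  by (induction A rule: infinite_finite_induct) (auto simp: Const_add)

lemma Const_prod: "Const (prod f A) = (\<Prod>i\<in>A. Const (f i))"
  by (induction A rule: infinite_finite_induct) (auto simp: Const_mult)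

lemma Const_of_nat: "Const (of_nat n) = of_nat n"
  by (induction n) (auto simp: Const_add)

lemma Const_uminus: "Const (- a) = - Const a"
  by (simp add: Const_def single_uminus)

lemma Const_diff: "Const (a - b) = Const a - Const b"
  using Const_add[of a "- b"] by (simp add: Const_uminus)

lemma peval_one [simp]: "peval 1 x = 1"
  using peval_Const[of 1 x] by simp

lemma peval_diff [simp]: "peval (p - q) x = peval p x - peval q x"
  using peval_add[of "p - q" q x] by simp

lemma peval_power [simp]: "peval (p ^ k) x = peval p x ^ k"
  by (induction k) auto

lemma peval_prod [simp]: "peval (prod f A) x = (\<Prod>i\<in>A. peval (f i) x)"
  by (induction A rule: infinite_finite_induct) auto

lemma continuous_on_peval [continuous_intros]: "continuous_on A (peval p)"
  unfolding peval_def by (intro continuous_intros)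

lemma sum_single_keys:
  "p = (\<Sum>e\<in>Poly_Mapping.keys p. Poly_Mapping.single e (Poly_Mapping.lookup p e))"
  by (rule poly_mapping_eqI) (auto simp: lookup_sum lookup_single when_def sum.delta in_keys_iff)

lemma single_eq_Const_mult_Vars:
  fixes e :: "'n::finite \<Rightarrow>\<^sub>0 nat"
  shows "Poly_Mapping.single e c = Const c * (\<Prod>i\<in>UNIV. Var i ^ Poly_Mapping.lookup e i)"
proof -
  have power: "Var i ^ k = Poly_Mapping.single (Poly_Mapping.single i k) 1" for i :: 'n and k
    by (induction k) (auto simp: Var_def mult_single single_add[symmetric])
  have prod: "(\<Prod>i\<in>A. Poly_Mapping.single (f i) (1::real)) = Poly_Mapping.single (sum f A) 1"
    for A :: "'n set" and f :: "'n \<Rightarrow> 'n \<Rightarrow>\<^sub>0 nat"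
    by (induction A rule: infinite_finite_induct) (auto simp: mult_single)
  have "(\<Sum>i\<in>UNIV. Poly_Mapping.single i (Poly_Mapping.lookup e i)) = e"
    by (rule poly_mapping_eqI) (auto simp: lookup_sum lookup_single when_def sum.delta)
  then show ?thesis
    by (simp add: power prod Const_def mult_single)
qed

lemma prod_power_indicator:
  fixes f :: "'a::finite \<Rightarrow> 'b::comm_monoid_mult"
  shows "(\<Prod>j\<in>UNIV. f j ^ (if j = i then 1 else 0)) = f i"
proof -
  have "(\<Prod>j\<in>UNIV. f j ^ (if j = i then 1 else 0)) = (\<Prod>j\<in>UNIV. if j = i then f j else 1)"
    by (rule prod.cong) auto
  then show ?thesis by simp
qed

section \<open>Semirings of polynomials\<close>

text \<open>
  With \<open>C = {0..}\<close> these are the semirings in which the representation is sought; with \<open>C = UNIV\<close>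
  they are the subalgebras, which serve to rewrite a polynomial in new coordinates.
\<close>

locale poly_semiring =
  fixes C :: "real set" and T :: "('n::finite) rpoly set"
  assumes Const_mem: "c \<in> C \<Longrightarrow> Const c \<in> T"
    and zero_in: "0 \<in> C"
    and one_in: "1 \<in> C"
    and add_mem: "a \<in> T \<Longrightarrow> b \<in> T \<Longrightarrow> a + b \<in> T"
    and mult_mem: "a \<in> T \<Longrightarrow> b \<in> T \<Longrightarrow> a * b \<in> T"
begin

lemma one_mem: "1 \<in> T"
  using Const_mem[OF one_in] by simp

lemma sum_mem: "(\<And>i. i \<in> A \<Longrightarrow> f i \<in> T) \<Longrightarrow> sum f A \<in> T"
  using Const_mem[OF zero_in] by (induction A rule: infinite_finite_induct) (auto intro: add_mem)

lemma prod_mem: "(\<And>i. i \<in> A \<Longrightarrow> f i \<in> T) \<Longrightarrow> prod f A \<in> T"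
  using one_mem by (induction A rule: infinite_finite_induct) (auto intro: mult_mem)

lemma power_mem: "a \<in> T \<Longrightarrow> a ^ k \<in> T"
  using one_mem by (induction k) (auto intro: mult_mem)

end

lemma poly_semiring_with_Vars_eq_UNIV:
  assumes "poly_semiring UNIV T" and Var: "\<And>i. Var i \<in> T"
  shows "f \<in> T"
proof -
  interpret poly_semiring UNIV T by fact
  show ?thesis
    by (subst sum_single_keys)
      (auto simp: single_eq_Const_mult_Vars intro!: sum_mem mult_mem prod_mem power_mem Const_mem Var)
qed

definition combinations :: "real set \<Rightarrow> ('i \<Rightarrow> ('n::finite) rpoly) \<Rightarrow> 'n rpoly set"
  where "combinations C M =
    {p. \<exists>A c. finite A \<and> (\<forall>i\<in>A. c i \<in> C) \<and> p = (\<Sum>i\<in>A. Const (c i) * M i)}"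

lemma combinationsI: "c \<in> C \<Longrightarrow> Const c * M i \<in> combinations C M"
  unfolding combinations_def by (auto intro!: exI[of _ "{i}"] exI[of _ "\<lambda>_. c"])

text \<open>
  The index of a product of two members of \<open>M\<close> is only required to exist, so the index type needs
  no addition of its own; this makes the lemma apply to triples of exponent functions.
\<close>

lemma poly_semiring_combinations:
  fixes M :: "'i \<Rightarrow> ('n::finite) rpoly"
  assumes zero: "0 \<in> C" and one: "1 \<in> C"
    and add: "\<And>a b. a \<in> C \<Longrightarrow> b \<in> C \<Longrightarrow> a + b \<in> C"
    and mult: "\<And>a b. a \<in> C \<Longrightarrow> b \<in> C \<Longrightarrow> a * b \<in> C"
    and M_one: "\<exists>i. M i = 1"
    and M_mult: "\<And>i j. \<exists>k. M k = M i * M j"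
  shows "poly_semiring C (combinations C M)"
proof
  show "0 \<in> C" "1 \<in> C" by fact+
  show "Const c \<in> combinations C M" if "c \<in> C" for c
    using M_one combinationsI[OF that, of M] by (metis mult.right_neutral)
  show add': "a + b \<in> combinations C M"
    if ab: "a \<in> combinations C M" "b \<in> combinations C M" for a b
  proof -
    obtain A c B d where fin: "finite A" "finite B" and cd: "\<forall>i\<in>A. c i \<in> C" "\<forall>i\<in>B. d i \<in> C"
      and a: "a = (\<Sum>i\<in>A. Const (c i) * M i)" and b: "b = (\<Sum>i\<in>B. Const (d i) * M i)"
      using ab by (auto simp: combinations_def)
    let ?c = "\<lambda>i. if i \<in> A then c i else 0" and ?d = "\<lambda>i. if i \<in> B then d i else 0"
    have "a = (\<Sum>i\<in>A \<union> B. Const (?c i) * M i)" "b = (\<Sum>i\<in>A \<union> B. Const (?d i) * M i)"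
      unfolding a b using fin by (auto intro!: sum.mono_neutral_cong_left)
    then have "a + b = (\<Sum>i\<in>A \<union> B. Const (?c i + ?d i) * M i)"
      by (simp add: Const_add ring_distribs sum.distrib)
    moreover have "\<forall>i\<in>A \<union> B. ?c i + ?d i \<in> C"
      using cd zero by (auto intro: add)
    ultimately show ?thesis
      using fin unfolding combinations_def
      by (intro CollectI exI[of _ "A \<union> B"] exI[of _ "\<lambda>i. ?c i + ?d i"]) simp
  qed
  have sum': "sum f A \<in> combinations C M" if "\<And>i. i \<in> A \<Longrightarrow> f i \<in> combinations C M"
    for f and A :: "'k set"
    using that
  proof (induction A rule: infinite_finite_induct)
    case (insert x F)
    then show ?case by (auto intro: add')
  qed (auto simp: combinations_def intro!: exI[of _ "{}"])
  show "a * b \<in> combinations C M"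
    if ab: "a \<in> combinations C M" "b \<in> combinations C M" for a b
  proof -
    obtain A c B d where cd: "\<forall>i\<in>A. c i \<in> C" "\<forall>i\<in>B. d i \<in> C"
      and a: "a = (\<Sum>i\<in>A. Const (c i) * M i)" and b: "b = (\<Sum>i\<in>B. Const (d i) * M i)"
      using ab by (auto simp: combinations_def)
    have "Const (c i) * M i * (Const (d j) * M j) \<in> combinations C M" if "i \<in> A" "j \<in> B" for i j
    proof -
      obtain k where "M k = M i * M j" using M_mult by blast
      then have "Const (c i) * M i * (Const (d j) * M j) = Const (c i * d j) * M k"
        by (simp add: Const_mult mult_ac)
      then show ?thesis
        using that cd by (auto intro!: combinationsI mult)
    qed
    then show ?thesis
      unfolding a b sum_product by (intro sum') auto
  qed
qed

section \<open>Bernstein coefficients\<close>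

text \<open>
  The quotient of the falling factorials of \<open>k\<close> and \<open>N\<close> of length \<open>e\<close>, which is the \<open>k\<close>-th
  coefficient of \<open>y\<^sup>e\<close> in the Bernstein basis of degree \<open>N\<close>. Truncated subtraction gives the right
  value \<open>0\<close> for \<open>k < e\<close>, and a quotient of falling factorials is easy to compare with \<open>(k / N)\<^sup>e\<close>
  factor by factor.
\<close>

definition bernstein_ratio :: "nat \<Rightarrow> nat \<Rightarrow> nat \<Rightarrow> real"
  where "bernstein_ratio N e k = (\<Prod>j<e. real (k - j) / real (N - j))"

lemma bernstein_ratio_eq_0: "k < e \<Longrightarrow> bernstein_ratio N e k = 0"
  unfolding bernstein_ratio_def by (intro prod_zero) auto

lemma bernstein_ratio_binomial:
  assumes "e \<le> k" "k \<le> N"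
  shows "bernstein_ratio N e k * real (N choose k) = real ((N - e) choose (k - e))"
  using assms
proof (induction e)
  case 0
  then show ?case by (simp add: bernstein_ratio_def)
next
  case (Suc e)
  have "(k - e) * ((N - e) choose (k - e)) = (N - e) * ((N - Suc e) choose (k - Suc e))"
    using times_binomial_minus1_eq[of "k - e" "N - e"] Suc.prems by simp
  then have "real (k - e) * real ((N - e) choose (k - e))
      = real (N - e) * real ((N - Suc e) choose (k - Suc e))"
    by (simp only: of_nat_mult[symmetric])
  moreover have "bernstein_ratio N (Suc e) k * real (N choose k)
      = real (k - e) / real (N - e) * (bernstein_ratio N e k * real (N choose k))"
    by (simp add: bernstein_ratio_def)
  moreover have "bernstein_ratio N e k * real (N choose k) = real ((N - e) choose (k - e))"
    using Suc by simp
  moreover have "real (N - e) \<noteq> 0"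
    using Suc.prems by simp
  ultimately show ?case
    by (simp only: times_divide_eq_left nonzero_mult_div_cancel_left not_False_eq_True)
qed

text \<open>
  Expand \<open>y\<^sup>e (y + z)\<^sup>N\<^sup>-\<^sup>e\<close> by the binomial theorem. Working with two ring elements whose sum
  is \<open>1\<close>, rather than with a variable, makes the identity usable in each rescaled coordinate of a box.
\<close>

lemma power_eq_sum_bernstein:
  fixes y z :: "('n::finite) rpoly"
  assumes "y + z = 1" "e \<le> N"
  shows "y ^ e = (\<Sum>k\<le>N. Const (bernstein_ratio N e k) *
    (Const (real (N choose k)) * y ^ k * z ^ (N - k)))"
proof -
  have "y ^ e = y ^ e * (y + z) ^ (N - e)"
    using assms by simp
  also have "\<dots> = (\<Sum>j\<le>N - e. of_nat ((N - e) choose j) * y ^ (j + e) * z ^ (N - e - j))"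
    by (simp add: binomial_ring sum_distrib_left power_add mult_ac)
  also have "\<dots> = (\<Sum>k\<in>{e..N}. of_nat ((N - e) choose (k - e)) * y ^ k * z ^ (N - k))"
    by (rule sum.reindex_bij_witness[of _ "\<lambda>k. k - e" "\<lambda>j. j + e"]) (use assms in \<open>auto simp: add.commute\<close>)
  also have "\<dots> = (\<Sum>k\<in>{e..N}. Const (bernstein_ratio N e k) *
      (Const (real (N choose k)) * y ^ k * z ^ (N - k)))"
  proof (intro sum.cong refl)
    fix k assume "k \<in> {e..N}"
    then have "Const (bernstein_ratio N e k) * Const (real (N choose k))
        = (of_nat ((N - e) choose (k - e)) :: 'n rpoly)"
      by (simp add: Const_mult[symmetric] bernstein_ratio_binomial flip: Const_of_nat)
    then show "of_nat ((N - e) choose (k - e)) * y ^ k * z ^ (N - k) = Const (bernstein_ratio N e k) *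
        (Const (real (N choose k)) * y ^ k * z ^ (N - k))"
      by (simp only: mult.assoc[symmetric])
  qed
  also have "\<dots> = (\<Sum>k\<le>N. Const (bernstein_ratio N e k) *
      (Const (real (N choose k)) * y ^ k * z ^ (N - k)))"
    by (intro sum.mono_neutral_left) (auto simp: bernstein_ratio_eq_0)
  finally show ?thesis .
qed

lemma bernstein_ratio_bounds:
  assumes "k \<le> N"
  shows "0 \<le> bernstein_ratio N e k" "bernstein_ratio N e k \<le> 1"
proof -
  show "0 \<le> bernstein_ratio N e k"
    unfolding bernstein_ratio_def by (intro prod_nonneg) auto
  show "bernstein_ratio N e k \<le> 1"
    unfolding bernstein_ratio_def using assms by (intro prod_le_1) (auto simp: divide_le_eq_1)
qed

text \<open>
  Each of the \<open>e\<close> factors \<open>(k - j) / (N - j)\<close> is within \<open>e / N\<close> of \<open>k / N\<close>, and all these numbers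
  lie in the unit interval, so the errors of the factors add up. The bound is uniform in \<open>k\<close>.
\<close>

lemma bernstein_ratio_approx:
  assumes "k \<le> N" "e \<le> N" "0 < N"
  shows "\<bar>bernstein_ratio N e k - (real k / real N) ^ e\<bar> \<le> real e * real e / real N"
proof -
  have factor: "\<bar>real (k - j) / real (N - j) - real k / real N\<bar> \<le> real e / real N" if "j < e" for j
  proof (cases "j \<le> k")
    case True
    have *: "real k / real N - real (k - j) / real (N - j)
        = real j / real N * (real (N - k) / real (N - j))"
      using True that assms by (simp add: of_nat_diff field_simps)
    have "0 \<le> real (N - k) / real (N - j)" "real (N - k) / real (N - j) \<le> 1"
      using True by (auto simp: divide_le_eq_1)
    then have "real j / real N * (real (N - k) / real (N - j)) \<le> real e / real N * 1"
      using that by (intro mult_mono divide_right_mono) auto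
    then have "real k / real N - real (k - j) / real (N - j) \<le> real e / real N"
      by (simp only: * mult_1_right)
    moreover have "0 \<le> real k / real N - real (k - j) / real (N - j)"
      unfolding * by simp
    ultimately show ?thesis
      by (metis abs_minus_commute abs_of_nonneg)
  next
    case False
    then show ?thesis using that by (auto simp: divide_right_mono)
  qed
  have "norm ((\<Prod>j<e. real (k - j) / real (N - j)) - (\<Prod>j<e. real k / real N))
      \<le> (\<Sum>j<e. norm (real (k - j) / real (N - j) - real k / real N))"
    by (rule norm_prod_diff) (use assms in \<open>auto simp: divide_le_eq_1\<close>)
  also have "\<dots> \<le> (\<Sum>j<e. real e / real N)"
    by (intro sum_mono) (use factor in auto)
  finally show ?thesis
    by (simp add: bernstein_ratio_def)
qed

section \<open>Polynomials positive on a box\<close>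

lemma compact_pos_lower_bound:
  fixes f :: "'a::topological_space \<Rightarrow> real"
  assumes "compact K" "continuous_on K f" "\<And>x. x \<in> K \<Longrightarrow> 0 < f x"
  obtains \<epsilon> where "0 < \<epsilon>" "\<And>x. x \<in> K \<Longrightarrow> \<epsilon> \<le> f x"
proof (cases "K = {}")
  case True
  then show ?thesis using that[of 1] by auto
next
  case False
  then obtain x where "x \<in> K" "\<forall>y\<in>K. f x \<le> f y"
    using continuous_attains_inf[OF assms(1) _ assms(2)] by blast
  then show ?thesis using that[of "f x"] assms(3) by auto
qed

lemma compact_vec_interval: "compact {x :: real ^ 'n. L \<le> x \<and> x \<le> U}"
proof -
  have "{x. L \<le> x \<and> x \<le> U} = cbox L U"
    by (auto simp: mem_box_cart less_eq_vec_def)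
  then show ?thesis by simp
qed

text \<open>
  Bernstein's theorem on a box: after rescaling to coordinates \<open>y\<^sub>i = (x\<^sub>i - L\<^sub>i) / (U\<^sub>i - L\<^sub>i)\<close>, the
  coefficients of \<open>f\<close> in the tensor product Bernstein basis approximate the values of \<open>f\<close> on a grid,
  and those are bounded away from \<open>0\<close>.
\<close>

lemma positive_on_proper_box_mem:
  fixes f :: "('n::finite) rpoly" and L U :: "real ^ 'n"
  assumes "poly_semiring {0..} T"
    and proper: "\<And>i. L $ i < U $ i"
    and lower: "\<And>i. Var i - Const (L $ i) \<in> T"
    and upper: "\<And>i. Const (U $ i) - Var i \<in> T"
    and pos: "\<And>x. L \<le> x \<Longrightarrow> x \<le> U \<Longrightarrow> 0 < peval f x"
  shows "f \<in> T"
proof -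
  interpret poly_semiring "{0..}" T by fact
  define w where "w i = U $ i - L $ i" for i
  have w: "0 < w i" for i using proper by (simp add: w_def)
  define y where "y i = Const (1 / w i) * (Var i - Const (L $ i))" for i
  define z where "z i = Const (1 / w i) * (Const (U $ i) - Var i)" for i
  have yT: "y i \<in> T" and zT: "z i \<in> T" for i
    unfolding y_def z_def using w[of i] by (auto intro!: mult_mem Const_mem lower upper)
  have yz: "y i + z i = 1" for i
  proof -
    have "y i + z i = Const (1 / w i) * Const (w i)"
      by (simp add: y_def z_def w_def Const_diff algebra_simps)
    then show ?thesis using w[of i] by (simp add: Const_mult[symmetric])
  qed
  \<comment> \<open>Change of coordinates: the polynomials in the \<open>y i\<close> form a subalgebra that contains every
      variable, hence every polynomial.\<close>
  let ?M = "\<lambda>e :: 'n \<Rightarrow> nat. \<Prod>i\<in>UNIV. y i ^ e i"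
  interpret M: poly_semiring UNIV "combinations UNIV ?M"
  proof (rule poly_semiring_combinations)
    show "\<exists>e. ?M e = 1" by (auto intro: exI[of _ "\<lambda>_. 0"])
    show "\<exists>k. ?M k = ?M i * ?M j" for i j
      by (auto simp: prod.distrib power_add intro: exI[of _ "\<lambda>l. i l + j l"])
  qed auto
  have "f \<in> combinations UNIV ?M"
  proof (rule poly_semiring_with_Vars_eq_UNIV)
    show "poly_semiring UNIV (combinations UNIV ?M)" ..
    fix i
    have "Var i = Const (w i) * y i + Const (L $ i)"
      using w[of i] by (simp add: y_def mult.assoc[symmetric] Const_mult[symmetric])
    moreover have "Const 1 * ?M (\<lambda>j. if j = i then 1 else 0) \<in> combinations UNIV ?M"
      by (rule combinationsI[where M = ?M]) simp
    then have "y i \<in> combinations UNIV ?M"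
      by (simp only: prod_power_indicator Const_one mult_1_left)
    ultimately show "Var i \<in> combinations UNIV ?M"
      by (simp add: M.add_mem M.mult_mem M.Const_mem)
  qed
  then obtain E c where E: "finite E" and f: "f = (\<Sum>e\<in>E. Const (c e) * ?M e)"
    by (auto simp: combinations_def)
  obtain \<epsilon> where \<epsilon>: "0 < \<epsilon>" "\<And>x. L \<le> x \<Longrightarrow> x \<le> U \<Longrightarrow> \<epsilon> \<le> peval f x"
  proof (rule compact_pos_lower_bound[OF compact_vec_interval[of L U] continuous_on_peval])
    show "0 < peval f x" if "x \<in> {x. L \<le> x \<and> x \<le> U}" for x
      using that pos by simp
  qed simp
  \<comment> \<open>\<open>K / N\<close> will bound the distance from a Bernstein coefficient to the grid value. Besides
      \<open>K / N \<le> \<epsilon>\<close>, the degree \<open>N\<close> has to be at least every exponent that occurs in \<open>f\<close>.\<close>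
  define K where "K = (\<Sum>e\<in>E. \<bar>c e\<bar> * (\<Sum>i\<in>UNIV. real (e i) * real (e i)))"
  define N where "N = Suc (nat \<lceil>K / \<epsilon>\<rceil>) + (\<Sum>e\<in>E. \<Sum>i\<in>UNIV. e i)"
  have N0: "0 < N" by (simp add: N_def)
  have eN: "e i \<le> N" if "e \<in> E" for e i
  proof -
    have "e i \<le> (\<Sum>i\<in>UNIV. e i)" by (rule le_sum_UNIV)
    also have "\<dots> \<le> (\<Sum>e\<in>E. \<Sum>i\<in>UNIV. e i)"
      using that E by (intro member_le_sum) auto
    finally show ?thesis by (simp add: N_def)
  qed
  have "K / \<epsilon> \<le> real N" unfolding N_def by linarith
  then have KN: "K / real N \<le> \<epsilon>"
    using \<epsilon>(1) N0 by (simp add: field_simps)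
  define b where "b \<kappa> = (\<Sum>e\<in>E. c e * (\<Prod>i\<in>UNIV. bernstein_ratio N (e i) (\<kappa> i)))"
    for \<kappa> :: "'n \<Rightarrow> nat"
  let ?B = "\<lambda>i k. Const (real (N choose k)) * y i ^ k * z i ^ (N - k)"
  let ?I = "PiE (UNIV :: 'n set) (\<lambda>_. {..N})"
  have "?M e = (\<Sum>\<kappa>\<in>?I. Const (\<Prod>i\<in>UNIV. bernstein_ratio N (e i) (\<kappa> i)) *
      (\<Prod>i\<in>UNIV. ?B i (\<kappa> i)))" if "e \<in> E" for e
  proof -
    have "?M e = (\<Prod>i\<in>UNIV. \<Sum>k\<in>{..N}. Const (bernstein_ratio N (e i) k) * ?B i k)"
      using that by (intro prod.cong refl power_eq_sum_bernstein yz eN)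
    also have "\<dots> = (\<Sum>\<kappa>\<in>?I. \<Prod>i\<in>UNIV. Const (bernstein_ratio N (e i) (\<kappa> i)) * ?B i (\<kappa> i))"
      by (rule prod_sum_PiE) auto
    finally show ?thesis by (simp only: prod.distrib Const_prod)
  qed
  then have "f = (\<Sum>e\<in>E. \<Sum>\<kappa>\<in>?I.
      Const (c e * (\<Prod>i\<in>UNIV. bernstein_ratio N (e i) (\<kappa> i))) * (\<Prod>i\<in>UNIV. ?B i (\<kappa> i)))"
    unfolding f by (intro sum.cong refl) (simp only: sum_distrib_left Const_mult mult.assoc)
  also have "\<dots> = (\<Sum>\<kappa>\<in>?I. Const (b \<kappa>) * (\<Prod>i\<in>UNIV. ?B i (\<kappa> i)))"
    by (subst sum.swap) (simp only: b_def Const_sum sum_distrib_right)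
  finally have f_bernstein: "f = (\<Sum>\<kappa>\<in>?I. Const (b \<kappa>) * (\<Prod>i\<in>UNIV. ?B i (\<kappa> i)))" .
  \<comment> \<open>The coefficient \<open>b \<kappa>\<close> is compared with the value of \<open>f\<close> at the grid point \<open>x\<close> of the box whose
      rescaled coordinates are \<open>\<kappa> i / N\<close>.\<close>
  have "0 \<le> b \<kappa>" if "\<kappa> \<in> ?I" for \<kappa>
  proof -
    have \<kappa>: "\<kappa> i \<le> N" for i using that by auto
    have grid_le_1: "real (\<kappa> i) / real N \<le> 1" for i
      using \<kappa>[of i] by (auto simp: divide_le_eq_1)
    define x where "x = (\<chi> i. L $ i + w i * (real (\<kappa> i) / real N))"
    have "L \<le> x"
      using w by (auto simp: x_def less_eq_vec_def less_imp_le)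
    moreover have "x \<le> U"
    proof -
      have "w i * (real (\<kappa> i) / real N) \<le> w i * 1" for i
        using w[of i] grid_le_1[of i] by (intro mult_left_mono) auto
      then show ?thesis
        by (simp add: x_def less_eq_vec_def w_def) (smt (verit))
    qed
    ultimately have "\<epsilon> \<le> peval f x" by (rule \<epsilon>)
    have "peval (y i) x = real (\<kappa> i) / real N" for i
      using w[of i] by (simp add: y_def x_def)
    then have fx: "peval f x = (\<Sum>e\<in>E. c e * (\<Prod>i\<in>UNIV. (real (\<kappa> i) / real N) ^ e i))"
      by (simp add: f)
    have "\<bar>(\<Prod>i\<in>UNIV. bernstein_ratio N (e i) (\<kappa> i)) - (\<Prod>i\<in>UNIV. (real (\<kappa> i) / real N) ^ e i)\<bar>
        \<le> (\<Sum>i\<in>UNIV. real (e i) * real (e i) / real N)" (is "\<bar>?P e - ?Q e\<bar> \<le> _") if "e \<in> E" for e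
    proof -
      have "norm (?P e - ?Q e) \<le> (\<Sum>i\<in>UNIV. norm (bernstein_ratio N (e i) (\<kappa> i) - (real (\<kappa> i) / real N) ^ e i))"
        by (rule norm_prod_diff)
          (use \<kappa> bernstein_ratio_bounds grid_le_1 in \<open>auto intro!: power_le_one\<close>)
      also have "\<dots> \<le> (\<Sum>i\<in>UNIV. real (e i) * real (e i) / real N)"
        using that by (intro sum_mono) (simp add: bernstein_ratio_approx \<kappa> eN N0)
      finally show ?thesis by simp
    qed
    then have "\<bar>c e * ?P e - c e * ?Q e\<bar> \<le> \<bar>c e\<bar> * (\<Sum>i\<in>UNIV. real (e i) * real (e i) / real N)"
      if "e \<in> E" for e
      using that by (simp only: right_diff_distrib[symmetric] abs_mult) (intro mult_left_mono, auto)
    then have "(\<Sum>e\<in>E. \<bar>c e * ?P e - c e * ?Q e\<bar>)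
        \<le> (\<Sum>e\<in>E. \<bar>c e\<bar> * (\<Sum>i\<in>UNIV. real (e i) * real (e i) / real N))"
      by (intro sum_mono)
    also have "\<dots> = K / real N"
      by (simp add: K_def flip: sum_divide_distrib)
    finally have "(\<Sum>e\<in>E. \<bar>c e * ?P e - c e * ?Q e\<bar>) \<le> \<epsilon>"
      using KN by linarith
    moreover have "\<bar>b \<kappa> - peval f x\<bar> \<le> (\<Sum>e\<in>E. \<bar>c e * ?P e - c e * ?Q e\<bar>)"
      unfolding fx b_def sum_subtractf[symmetric] by (rule sum_abs)
    ultimately show ?thesis
      using \<open>\<epsilon> \<le> peval f x\<close> by linarith
  qed
  then show ?thesis
    by (subst f_bernstein)
      (auto intro!: sum_mem mult_mem prod_mem power_mem yT zT Const_mem)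
qed

text \<open>
  Sides of length \<open>0\<close> cannot be rescaled. They are removed by moving every \<open>U $ i\<close> up by a small
  \<open>\<eta>\<close> such that \<open>f\<close> remains positive on the larger box.
\<close>

lemma positive_on_box_mem:
  fixes f :: "('n::finite) rpoly" and L U :: "real ^ 'n"
  assumes T: "poly_semiring {0..} T"
    and LU: "L \<le> U"
    and lower: "\<And>i. Var i - Const (L $ i) \<in> T"
    and upper: "\<And>i. Const (U $ i) - Var i \<in> T"
    and pos: "\<And>x. L \<le> x \<Longrightarrow> x \<le> U \<Longrightarrow> 0 < peval f x"
  shows "f \<in> T"
proof -
  interpret poly_semiring "{0..}" T by fact
  have "open {x. 0 < peval f x}"
    by (intro open_Collect_less continuous_on_const continuous_on_peval)
  then obtain \<delta> where \<delta>: "0 < \<delta>" "(\<Union>x\<in>{x. L \<le> x \<and> x \<le> U}. ball x \<delta>) \<subseteq> {x. 0 < peval f x}"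
  proof (rule compact_subset_open_imp_ball_epsilon_subset[OF compact_vec_interval[of L U]])
    show "{x. L \<le> x \<and> x \<le> U} \<subseteq> {x. 0 < peval f x}" using pos by auto
  qed
  define \<eta> where "\<eta> = \<delta> / (2 * real CARD('n))"
  have \<eta>: "0 < \<eta>" using \<delta>(1) by (simp add: \<eta>_def)
  define U' where "U' = (\<chi> i. U $ i + \<eta>)"
  show ?thesis
  proof (rule positive_on_proper_box_mem[OF T, of L U'])
    show "L $ i < U' $ i" for i
      using LU \<eta> by (simp add: U'_def less_eq_vec_def add.commute add_strict_increasing)
    show "Var i - Const (L $ i) \<in> T" for i by (rule lower)
    have "Const \<eta> + (Const (U $ i) - Var i) \<in> T" for i
      using \<eta> by (intro add_mem upper Const_mem) auto
    then show "Const (U' $ i) - Var i \<in> T" for i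
      by (simp add: U'_def Const_add algebra_simps)
    fix x assume x: "L \<le> x" "x \<le> U'"
    define x' where "x' = (\<chi> i. min (x $ i) (U $ i))"
    have "L \<le> x'" "x' \<le> U"
      using x LU by (auto simp: x'_def less_eq_vec_def)
    moreover have "dist x' x < \<delta>"
    proof -
      have "dist x' x \<le> (\<Sum>i\<in>UNIV. \<bar>(x' - x) $ i\<bar>)"
        unfolding dist_norm by (rule norm_le_l1_cart)
      also have "\<dots> \<le> (\<Sum>i\<in>(UNIV :: 'n set). \<eta>)"
      proof (rule sum_mono)
        fix i
        have "x $ i \<le> U $ i + \<eta>" using x(2) by (simp add: U'_def less_eq_vec_def)
        then show "\<bar>(x' - x) $ i\<bar> \<le> \<eta>" using \<eta> by (simp add: x'_def min_def)
      qed
      also have "\<dots> < \<delta>" using \<delta>(1) by (simp add: \<eta>_def)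
      finally show ?thesis .
    qed
    ultimately show "0 < peval f x" using \<delta>(2) by (auto simp: subset_eq)
  qed
qed

section \<open>From a box to the semialgebraic set\<close>

text \<open>
  Both regimes come from Bernoulli's inequality: for \<open>t \<ge> 0\<close> it gives
  \<open>(1 - t)\<^sup>k (1 + k t) \<le> (1 - t\<^sup>2)\<^sup>k \<le> 1\<close>, and for \<open>t < 0\<close> it bounds \<open>(1 - t)\<^sup>k\<close> below by \<open>1 - k t\<close>.
  The squared negative part lets one formula, continuous in \<open>t\<close>, cover both.
\<close>

lemma penalty_bound:
  fixes t :: real
  assumes "t \<le> 1" "0 < k"
  shows "t * (1 - t) ^ k \<le> 1 / real k - real k * (max 0 (- t))\<^sup>2"
proof (cases "0 \<le> t")
  case True
  have "(1 - t) ^ k * (1 + real k * t) \<le> (1 - t) ^ k * (1 + t) ^ k"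
    using assms True by (intro mult_left_mono Bernoulli_inequality) auto
  also have "\<dots> = (1 - t\<^sup>2) ^ k"
    by (simp add: power_mult_distrib[symmetric] power2_eq_square algebra_simps)
  also have "\<dots> \<le> 1"
    using True assms by (intro power_le_one) (auto simp: power_le_one)
  finally have "(1 - t) ^ k + real k * (t * (1 - t) ^ k) \<le> 1"
    by (simp add: algebra_simps)
  moreover have "0 \<le> (1 - t) ^ k" using assms by simp
  ultimately have "real k * (t * (1 - t) ^ k) \<le> 1" by linarith
  then show ?thesis
    using True assms by (simp add: field_simps max_def)
next
  case False
  have "1 + real k * (- t) \<le> (1 + - t) ^ k"
    using False by (intro Bernoulli_inequality) auto
  then have "t * (1 - t) ^ k \<le> t * (1 + real k * (- t))"
    using False by (intro mult_left_mono_neg) auto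
  also have "\<dots> \<le> - (real k * t\<^sup>2)"
    using False by (simp add: power2_eq_square algebra_simps)
  finally show ?thesis
    using False assms by (simp add: max_def) (smt (verit) divide_nonneg_nonneg of_nat_0_le_iff)
qed

text \<open>
  On the box, \<open>h\<close> is at most \<open>m / k - k s\<close>, where \<open>m\<close> is the number of constraints and \<open>s\<close> measures
  how far they are violated. Where \<open>p\<close> is not safely positive, \<open>s\<close> is bounded away from \<open>0\<close> by
  compactness, so for large \<open>k\<close> the term \<open>k s\<close> makes up for the negative values of \<open>p\<close>.
\<close>

lemma positive_on_semialgebraic_mem:
  fixes g :: "'m::finite \<Rightarrow> ('n::finite) rpoly" and p :: "'n rpoly" and L U :: "real ^ 'n"
  assumes T: "poly_semiring {0..} T"
    and LU: "L \<le> U"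
    and lower: "\<And>i. Var i - Const (L $ i) \<in> T"
    and upper: "\<And>i. Const (U $ i) - Var i \<in> T"
    and gT: "\<And>j. g j \<in> T"
    and pos: "\<And>x. L \<le> x \<Longrightarrow> x \<le> U \<Longrightarrow> (\<And>j. 0 \<le> peval (g j) x) \<Longrightarrow> 0 < peval p x"
  shows "p \<in> T"
proof -
  interpret poly_semiring "{0..}" T by fact
  let ?Q = "{x. L \<le> x \<and> x \<le> U}"
  have bounded: "\<exists>B>0. \<forall>x\<in>?Q. \<bar>f x\<bar> < B" if "continuous_on ?Q f" for f :: "real ^ 'n \<Rightarrow> real"
  proof -
    have "bounded (f ` ?Q)"
      using that by (intro compact_imp_bounded compact_continuous_image compact_vec_interval)
    then obtain B where "B > 0" "\<forall>x\<in>?Q. \<bar>f x\<bar> \<le> B" by (auto simp: bounded_pos)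
    then show ?thesis by (intro exI[of _ "B + 1"]) force
  qed
  \<comment> \<open>A bound for the sum of the \<open>\<bar>g j\<bar>\<close> bounds all of them at once.\<close>
  have "continuous_on ?Q (\<lambda>x. \<Sum>j\<in>UNIV. \<bar>peval (g j) x\<bar>)"
    by (intro continuous_intros)
  then obtain B where "0 < B" and B: "\<forall>x\<in>?Q. \<bar>\<Sum>j\<in>UNIV. \<bar>peval (g j) x\<bar>\<bar> < B"
    using bounded by blast
  define G where "G j = Const (1 / B) * g j" for j
  have G_le: "peval (G j) x < 1" if "x \<in> ?Q" for j x
  proof -
    have "peval (g j) x \<le> \<bar>peval (g j) x\<bar>" by simp
    also have "\<dots> \<le> (\<Sum>j\<in>UNIV. \<bar>peval (g j) x\<bar>)" by (rule member_le_sum) auto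
    also have "\<dots> < B" using B that by fastforce
    finally show ?thesis using \<open>0 < B\<close> by (simp add: G_def)
  qed
  have GT: "G j \<in> T" for j
    unfolding G_def using \<open>0 < B\<close> by (intro mult_mem Const_mem gT) auto
  have G1T: "1 - G j \<in> T" for j
    by (rule positive_on_box_mem[OF T LU lower upper]) (simp add: G_le)
  define s where "s x = (\<Sum>j\<in>UNIV. (max 0 (- peval (G j) x))\<^sup>2)" for x
  have s_nonneg: "0 \<le> s x" for x by (simp add: s_def sum_nonneg)
  have s_cont: "continuous_on A s" for A
    unfolding s_def by (intro continuous_intros)
  have s_pos: "0 < s x" if "x \<in> ?Q" "peval p x \<le> 0" for x
  proof -
    have "\<not> (\<forall>j. 0 \<le> peval (g j) x)"
      using pos[of x] that by auto
    then obtain j where "peval (g j) x < 0" by (auto simp: not_le)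
    then have "peval (G j) x < 0"
      using \<open>0 < B\<close> by (simp add: G_def divide_neg_pos)
    then have "0 < (max 0 (- peval (G j) x))\<^sup>2"
      by (simp add: max_def)
    also have "\<dots> \<le> s x" unfolding s_def by (rule member_le_sum) auto
    finally show ?thesis .
  qed
  \<comment> \<open>Every point of the box satisfies \<open>p > 0\<close> or \<open>s > 0\<close>; taking the maximum of the two turns this
      alternative into a uniform one.\<close>
  have "continuous_on ?Q (\<lambda>x. max (peval p x) (s x))"
    by (intro continuous_intros s_cont)
  moreover have "0 < max (peval p x) (s x)" if "x \<in> ?Q" for x
    using s_pos[OF that] by (fastforce simp: less_max_iff_disj not_le)
  ultimately obtain \<epsilon> where \<epsilon>: "0 < \<epsilon>" "\<And>x. x \<in> ?Q \<Longrightarrow> \<epsilon> \<le> max (peval p x) (s x)"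
    by (rule compact_pos_lower_bound[OF compact_vec_interval]) (assumption | rule that)+
  obtain R where "0 < R" and R: "\<forall>x\<in>?Q. \<bar>peval p x\<bar> < R"
    using bounded[OF continuous_on_peval] by blast
  let ?m = "real CARD('m)"
  \<comment> \<open>\<open>k\<close> must beat \<open>(R + m) / \<epsilon>\<close> where \<open>s \<ge> \<epsilon>\<close>, and \<open>m / \<epsilon>\<close> where \<open>p \<ge> \<epsilon>\<close>.\<close>
  obtain k :: nat where k: "(R + ?m) / \<epsilon> + ?m / \<epsilon> + 1 < real k"
    using reals_Archimedean2 by blast
  have nn: "0 \<le> (R + ?m) / \<epsilon>" "0 \<le> ?m / \<epsilon>" using \<epsilon>(1) \<open>0 < R\<close> by auto
  have k1: "1 < real k" using k nn by linarith
  have "(R + ?m) / \<epsilon> < real k" "?m / \<epsilon> < real k" using k nn by linarith+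
  then have k2: "R + ?m < real k * \<epsilon>" and k3: "?m / real k < \<epsilon>"
    using \<epsilon>(1) k1 by (simp_all add: field_simps)
  define h where "h = (\<Sum>j\<in>UNIV. G j * (1 - G j) ^ k)"
  have "0 < peval (p - h) x" if x: "L \<le> x" "x \<le> U" for x
  proof -
    have xQ: "x \<in> ?Q" using x by simp
    have "peval h x = (\<Sum>j\<in>UNIV. peval (G j) x * (1 - peval (G j) x) ^ k)"
      by (simp add: h_def)
    also have "\<dots> \<le> (\<Sum>j\<in>UNIV. 1 / real k - real k * (max 0 (- peval (G j) x))\<^sup>2)"
      using k1 G_le[OF xQ] by (intro sum_mono penalty_bound) (auto simp: less_imp_le)
    also have "\<dots> = ?m / real k - real k * s x"
      by (simp add: sum_subtractf s_def sum_distrib_left)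
    finally have h: "peval h x \<le> ?m / real k - real k * s x" .
    show ?thesis
    proof (cases "\<epsilon> \<le> peval p x")
      case True
      moreover have "0 \<le> real k * s x" using s_nonneg by simp
      ultimately show ?thesis using h k3 by simp
    next
      case False
      then have "\<epsilon> \<le> s x" using \<epsilon>(2)[OF xQ] by (auto simp: max_def split: if_splits)
      then have "real k * \<epsilon> \<le> real k * s x" by (intro mult_left_mono) auto
      moreover have "?m / real k \<le> ?m" using k1 by (simp add: field_simps)
      moreover have "- R < peval p x" using R xQ by force
      ultimately show ?thesis using h k2 by simp
    qed
  qed
  then have "p - h \<in> T" by (rule positive_on_box_mem[OF T LU lower upper])
  moreover have "h \<in> T"
    unfolding h_def by (intro sum_mem mult_mem power_mem GT G1T)
  ultimately show ?thesis using add_mem[of "p - h" h] by simp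
qed

section \<open>The representation\<close>

lemma dsos_Const:
  assumes "0 \<le> c"
  shows "dsos (Const c)"
  unfolding dsos_def using assms
  by (intro exI[of _ 1] exI[of _ "\<lambda>_. 0"] exI[of _ "\<lambda>_. c"] exI[of _ "\<lambda>_ _. 0"])
    (simp add: Monom_def)

lemma sdsos_Const:
  assumes "0 \<le> c"
  shows "sdsos (Const c)"
  unfolding sdsos_def using assms
  by (intro exI[of _ 1] exI[of _ "\<lambda>_. 0"] exI[of _ "\<lambda>_. c"] exI[of _ "\<lambda>_ _. 0"])
    (simp add: Monom_def)

lemma Const_in_polys_upto: "Const c \<in> polys_upto r"
  by (auto simp: polys_upto_def Const_def split: if_splits)

text \<open>
  Krivine's representation, obtained from the fact that the products \<open>box_product\<close> are closed under
  multiplication and include every generator.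
\<close>

lemma positive_imp_nonneg_combination_box_products:
  fixes g :: "'m::finite \<Rightarrow> ('n::finite) rpoly" and p :: "'n rpoly" and L U :: "real ^ 'n"
  assumes LU: "L \<le> U"
    and pos: "\<And>x. L \<le> x \<Longrightarrow> x \<le> U \<Longrightarrow> (\<And>j. 0 \<le> peval (g j) x) \<Longrightarrow> 0 < peval p x"
  obtains r c where "\<And>\<alpha> \<beta> \<gamma>. 0 \<le> c \<alpha> \<beta> \<gamma>"
    and "p = (\<Sum>(\<alpha>, \<beta>, \<gamma>)\<in>multi_indices r. Const (c \<alpha> \<beta> \<gamma>) * box_product L U g \<alpha> \<beta> \<gamma>)"
proof -
  let ?M = "\<lambda>(\<alpha>, \<beta>, \<gamma>). box_product L U g \<alpha> \<beta> \<gamma>"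
  let ?T = "combinations {0..} ?M"
  let ?u = "\<lambda>i j. if j = i then 1 else (0::nat)"
  have M1: "Const 1 * ?M t \<in> ?T" for t by (rule combinationsI) simp
  have "p \<in> ?T"
  proof (rule positive_on_semialgebraic_mem[OF _ LU _ _ _ pos])
    show "poly_semiring {0..} ?T"
    proof (rule poly_semiring_combinations)
      show "\<exists>t. ?M t = 1"
        by (auto simp: box_product_def intro!: exI[of _ "\<lambda>_. 0"])
      show "\<exists>t. ?M t = ?M t1 * ?M t2" for t1 t2
      proof -
        obtain \<alpha> \<beta> \<gamma> \<alpha>' \<beta>' \<gamma>' where "t1 = (\<alpha>, \<beta>, \<gamma>)" "t2 = (\<alpha>', \<beta>', \<gamma>')"
          by (metis prod_cases3)
        then show ?thesis
          by (intro exI[of _ "(\<lambda>i. \<alpha> i + \<alpha>' i, \<lambda>i. \<beta> i + \<beta>' i, \<lambda>j. \<gamma> j + \<gamma>' j)"])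
            (simp add: box_product_def power_add prod.distrib mult_ac)
      qed
    qed auto
    show "Var i - Const (L $ i) \<in> ?T" for i
      using M1[of "(?u i, \<lambda>_. 0, \<lambda>_. 0)"] by (simp add: box_product_def prod_power_indicator del: One_nat_def)
    show "Const (U $ i) - Var i \<in> ?T" for i
      using M1[of "(\<lambda>_. 0, ?u i, \<lambda>_. 0)"] by (simp add: box_product_def prod_power_indicator del: One_nat_def)
    show "g j \<in> ?T" for j
      using M1[of "(\<lambda>_. 0, \<lambda>_. 0, ?u j)"] by (simp add: box_product_def prod_power_indicator del: One_nat_def)
  qed auto
  then obtain A c where A: "finite A" and c: "\<forall>t\<in>A. 0 \<le> c t"
    and p: "p = (\<Sum>t\<in>A. Const (c t) * ?M t)"
    by (auto simp: combinations_def)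
  let ?deg = "\<lambda>(\<alpha>, \<beta>, \<gamma>). (\<Sum>i\<in>UNIV. \<alpha> i) + (\<Sum>i\<in>UNIV. \<beta> i) + (\<Sum>j\<in>UNIV. \<gamma> j) :: nat"
  define r where "r = (\<Sum>t\<in>A. ?deg t)"
  have "?deg t \<le> r" if "t \<in> A" for t
    unfolding r_def using A that by (intro member_le_sum) auto
  then have sub: "A \<subseteq> multi_indices r"
    by (force simp: multi_indices_def)
  \<comment> \<open>The index set \<open>A\<close> is filled up to all of \<open>multi_indices r\<close> with coefficients \<open>0\<close>.\<close>
  define d where "d \<alpha> \<beta> \<gamma> = (if (\<alpha>, \<beta>, \<gamma>) \<in> A then c (\<alpha>, \<beta>, \<gamma>) else 0)" for \<alpha> \<beta> \<gamma>
  have "p = (\<Sum>t\<in>multi_indices r. Const (if t \<in> A then c t else 0) * ?M t)"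
    unfolding p by (rule sum.mono_neutral_cong_left) (use sub finite_multi_indices in auto)
  also have "\<dots> = (\<Sum>(\<alpha>, \<beta>, \<gamma>)\<in>multi_indices r. Const (d \<alpha> \<beta> \<gamma>) * box_product L U g \<alpha> \<beta> \<gamma>)"
    by (intro sum.cong refl) (auto simp: d_def)
  finally show ?thesis
    using c by (intro that[of d r]) (auto simp: d_def)
qed

theorem corollary2:
  fixes g :: "'m::finite \<Rightarrow> ('n::finite) rpoly"
    and p :: "'n rpoly"
    and L U :: "real ^ 'n"
    and S :: "(real ^ 'n) set"
  assumes S_def: "S = {x. \<forall>j. peval (g j) x \<ge> 0}"
    and S_nonempty: "S \<noteq> {}"
    and S_compact: "compact S"
    and S_box: "S \<subseteq> {x. L \<le> x \<and> x \<le> U}"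
    and p_pos: "\<And>x. x \<in> S \<Longrightarrow> peval p x > 0"
  shows
    "(\<exists>(r::nat) (q :: ('n \<Rightarrow> nat) \<Rightarrow> ('n \<Rightarrow> nat) \<Rightarrow> ('m \<Rightarrow> nat) \<Rightarrow> 'n rpoly).
        (\<forall>(\<alpha>, \<beta>, \<gamma>) \<in> multi_indices r. sdsos (q \<alpha> \<beta> \<gamma>) \<and> q \<alpha> \<beta> \<gamma> \<in> polys_upto r) \<and>
        p = (\<Sum>(\<alpha>, \<beta>, \<gamma>) \<in> multi_indices r. q \<alpha> \<beta> \<gamma> * box_product L U g \<alpha> \<beta> \<gamma>)) \<and>
     (\<exists>(r::nat) (q :: ('n \<Rightarrow> nat) \<Rightarrow> ('n \<Rightarrow> nat) \<Rightarrow> ('m \<Rightarrow> nat) \<Rightarrow> 'n rpoly).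
        (\<forall>(\<alpha>, \<beta>, \<gamma>) \<in> multi_indices r. dsos (q \<alpha> \<beta> \<gamma>) \<and> q \<alpha> \<beta> \<gamma> \<in> polys_upto r) \<and>
        p = (\<Sum>(\<alpha>, \<beta>, \<gamma>) \<in> multi_indices r. q \<alpha> \<beta> \<gamma> * box_product L U g \<alpha> \<beta> \<gamma>))"
proof -
  have "L \<le> U"
    using S_nonempty S_box by (force intro: order_trans)
  then obtain r c where c: "\<And>\<alpha> \<beta> \<gamma>. 0 \<le> c \<alpha> \<beta> \<gamma>"
    and p: "p = (\<Sum>(\<alpha>, \<beta>, \<gamma>)\<in>multi_indices r. Const (c \<alpha> \<beta> \<gamma>) * box_product L U g \<alpha> \<beta> \<gamma>)"
  proof (rule positive_imp_nonneg_combination_box_products)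
    show "0 < peval p x" if "\<And>j. 0 \<le> peval (g j) x" for x
      using p_pos[of x] that by (simp add: S_def)
  qed (rule that)
  let ?q = "\<lambda>\<alpha> \<beta> \<gamma>. Const (c \<alpha> \<beta> \<gamma>)"
  show ?thesis
    by (intro conjI exI[of _ r] exI[of _ ?q])
      (use p c in \<open>auto simp: sdsos_Const dsos_Const Const_in_polys_upto\<close>)
qed

end
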